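(* Let $n\ge1$, let $\sigma$ be an endomorphism of $\mathrm{Free}_n(\mathcal{MV})$, let $\bar s:[0,1]^n\to[0,1]^n$ and $S:X\to X$ be the associated maps, where $X=\mathrm{Spec}\,\mathrm{Free}_n(\mathcal{MV})$. Then $\bar s$ is nonsingular with respect to Lebesgue measure $\lambda$ iff $S$ is nonsingular with respect to $\lambda$ on $X$. If this happens, then the systems $([0,1]^n,\lambda,\bar s)$ and $(X,\lambda,S)$ are isomorphic under $\pi$: there are Borel sets $A_1\subseteq[0,1]^n$, $A_2\subseteq X$ of full measure with $\bar s[A_1]\subseteq A_1$, $S[A_2]\subseteq A_2$, such that $\pi\restriction A_1$ is a measure-preserving Borel isomorphism onto $A_2$ with $\pi\circ\bar s=S\circ\pi$ on $A_1$.
   Context: $\mathrm{Free}_n(\mathcal{MV})$ is the free MV-algebra on $n$ generators, realized as the algebra of McNaughton functions on $[0,1]^n$ (continuous $t:[0,1]^n\to[0,1]$ that are piecewise affine with finitely many pieces, each of the form $a^0x_0+\dots+a^{n-1}x_{n-1}+a^n$ with integer $a^i$) under pointwise Łukasiewicz operations ($a\star b=\max(0,a+b-1)$, $a\to b=\min(1,1-a+b)$, constants $0,1$); $x_0,\dots,x_{n-1}$ are the coordinate projections. A filter is the preimage of $1$ under a homomorphism; $X$ is the set of proper prime filters with the topology whose subbasis is the sets $O_a=\{\mathfrak p: a\notin\mathfrak p\}$. $\pi:[0,1]^n\to X$, $\pi(p)=\{t: t(p)=1\}$; $\lambda$ on $X$ is $\lambda(A)=\lambda(\pi^{-1}[A])$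 with $\lambda$ Lebesgue measure on $[0,1]^n$. For $\sigma$ with $s_i=\sigma(x_i)$, $\bar s(p)=(s_0(p),\dots,s_{n-1}(p))$ and $S(\mathfrak p)=\sigma^{-1}[\mathfrak p]$. A measurable map $T$ on a probability space is nonsingular if $\mu(A)=0$ implies $\mu(T^{-1}[A])=0$. *)

theory Defs
  imports "HOL-Probability.Probability" "HOL-Algebra.Group"
begin

text \<open>The monoid operation is the strong conjunction (with unit 1).\<close>

record 'a mv_alg = "'a monoid" +
  mv_imp :: "['a, 'a] \<Rightarrow> 'a" (infixr "\<leadsto>\<index>" 65)
  mv_zero :: 'a ("\<bottom>\<index>")

text \<open>
  With \<open>\<not>x = x \<leadsto> \<bottom>\<close> and \<open>x \<oplus> y = \<not>x \<leadsto> y\<close> these are Chang's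
  axioms for \<open>(\<oplus>, \<not>, 0)\<close>, with the other operations expressed through these
  as usual.
\<close>

locale mv_algebra = comm_monoid A for A :: "'a mv_alg" (structure) +
  assumes zero_closed: "\<bottom> \<in> carrier A"
    and imp_closed: "\<lbrakk>x \<in> carrier A; y \<in> carrier A\<rbrakk> \<Longrightarrow> x \<leadsto> y \<in> carrier A"
    and mult_zero: "x \<in> carrier A \<Longrightarrow> x \<otimes> \<bottom> = \<bottom>"
    and double_neg: "x \<in> carrier A \<Longrightarrow> (x \<leadsto> \<bottom>) \<leadsto> \<bottom> = x"
    and imp_eq: "\<lbrakk>x \<in> carrier A; y \<in> carrier A\<rbrakk> \<Longrightarrow> x \<leadsto> y = (x \<otimes> (y \<leadsto> \<bottom>)) \<leadsto> \<bottom>"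
    and imp_imp_commute:
      "\<lbrakk>x \<in> carrier A; y \<in> carrier A\<rbrakk> \<Longrightarrow> (x \<leadsto> y) \<leadsto> y = (y \<leadsto> x) \<leadsto> x"

definition mv_hom :: "'a mv_alg \<Rightarrow> 'b mv_alg \<Rightarrow> ('a \<Rightarrow> 'b) set" where
  "mv_hom A B = {h \<in> hom A B.
     (\<forall>x\<in>carrier A. \<forall>y\<in>carrier A. h (x \<leadsto>\<^bsub>A\<^esub> y) = h x \<leadsto>\<^bsub>B\<^esub> h y) \<and>
     h \<bottom>\<^bsub>A\<^esub> = \<bottom>\<^bsub>B\<^esub> \<and> h \<one>\<^bsub>A\<^esub> = \<one>\<^bsub>B\<^esub>}"

text \<open>
  A filter is the preimage of 1 under a homomorphism into some MV-algebra. A definition cannot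
  quantify over types, so the target lives on the type of subsets of the source, where the
  quotients of the source live; lemma \<open>mv_filter_preimage\<close> below shows that targets on
  other types yield no further filters.
\<close>

definition mv_filter :: "'a mv_alg \<Rightarrow> 'a set \<Rightarrow> bool" where
  "mv_filter A F \<longleftrightarrow> (\<exists>(B :: 'a set mv_alg) h.
     mv_algebra B \<and> h \<in> mv_hom A B \<and> F = {a \<in> carrier A. h a = \<one>\<^bsub>B\<^esub>})"

text \<open>Equivalently for a filter, its quotient is totally ordered.\<close>

definition mv_prime :: "'a mv_alg \<Rightarrow> 'a set \<Rightarrow> bool" where
  "mv_prime A F \<longleftrightarrow>
     (\<forall>a\<in>carrier A. \<forall>b\<in>carrier A. a \<leadsto>\<^bsub>A\<^esub> b \<in> F \<or> b \<leadsto>\<^bsub>A\<^esub> a \<in> F)"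

definition mv_Spec :: "'a mv_alg \<Rightarrow> 'a set set" where
  "mv_Spec A = {F. mv_filter A F \<and> F \<noteq> carrier A \<and> mv_prime A F}"

definition mv_Spec_topology :: "'a mv_alg \<Rightarrow> 'a set topology" where
  "mv_Spec_topology A = topology_generated_by {{P \<in> mv_Spec A. a \<notin> P} | a. a \<in> carrier A}"

definition mv_Spec_borel :: "'a mv_alg \<Rightarrow> 'a set measure" where
  "mv_Spec_borel A = sigma (mv_Spec A) {U. openin (mv_Spec_topology A) U}"

definition Spec_map :: "'a mv_alg \<Rightarrow> ('a \<Rightarrow> 'a) \<Rightarrow> 'a set \<Rightarrow> 'a set" where
  "Spec_map A \<sigma> P = {a \<in> carrier A. \<sigma> a \<in> P}"

lemma mv_filter_preimage:
  fixes A :: "'a mv_alg" and B :: "'b mv_alg"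
  assumes A: "mv_algebra A" and B: "mv_algebra B" and h: "h \<in> mv_hom A B"
  shows "mv_filter A {a \<in> carrier A. h a = \<one>\<^bsub>B\<^esub>}"
proof -
  interpret A: mv_algebra A by fact
  interpret B: mv_algebra B by fact
  define C where "C a = {x \<in> carrier A. h x = h a}" for a
  define r where "r X = (SOME a. a \<in> X)" for X :: "'a set"
  define Q where "Q = \<lparr>carrier = C ` carrier A, mult = (\<lambda>X Y. C (r X \<otimes>\<^bsub>A\<^esub> r Y)),
     one = C \<one>\<^bsub>A\<^esub>, mv_imp = (\<lambda>X Y. C (r X \<leadsto>\<^bsub>A\<^esub> r Y)), mv_zero = C \<bottom>\<^bsub>A\<^esub>\<rparr>"
  have hm: "h (x \<otimes>\<^bsub>A\<^esub> y) = h x \<otimes>\<^bsub>B\<^esub> h y" "h (x \<leadsto>\<^bsub>A\<^esub> y) = h x \<leadsto>\<^bsub>B\<^esub> h y" "h x \<in> carrier B"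
    if "x \<in> carrier A" "y \<in> carrier A" for x y
    using h that by (auto simp: mv_hom_def hom_def)
  have h01: "h \<bottom>\<^bsub>A\<^esub> = \<bottom>\<^bsub>B\<^esub>" "h \<one>\<^bsub>A\<^esub> = \<one>\<^bsub>B\<^esub>"
    using h by (auto simp: mv_hom_def)
  have CC: "C a = C b \<longleftrightarrow> h a = h b" if "a \<in> carrier A" "b \<in> carrier A" for a b
    using that by (auto simp: C_def)
  have r: "r (C a) \<in> carrier A \<and> h (r (C a)) = h a" if "a \<in> carrier A" for a
  proof -
    have "r (C a) \<in> C a" unfolding r_def by (rule someI[of _ a]) (simp add: C_def that)
    then show ?thesis by (simp add: C_def)
  qed
  have ops: "C a \<otimes>\<^bsub>Q\<^esub> C b = C (a \<otimes>\<^bsub>A\<^esub> b)" "C a \<leadsto>\<^bsub>Q\<^esub> C b = C (a \<leadsto>\<^bsub>A\<^esub> b)"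
    if "a \<in> carrier A" "b \<in> carrier A" for a b
    using r[OF that(1)] r[OF that(2)] that by (auto simp: Q_def CC A.imp_closed hm)
  have Q0: "\<one>\<^bsub>Q\<^esub> = C \<one>\<^bsub>A\<^esub>" "\<bottom>\<^bsub>Q\<^esub> = C \<bottom>\<^bsub>A\<^esub>" "carrier Q = C ` carrier A"
    by (simp_all add: Q_def)
  have "mv_algebra Q"
  proof (unfold_locales, unfold Q0, goal_cases)
    case (2 x y z) then show ?case by (elim imageE, hypsubst) (simp add: ops A.m_assoc)
  next
    case (6 x y) then show ?case by (elim imageE, hypsubst) (simp add: ops A.m_comm)
  next
    case (11 x y) then show ?case
      by (elim imageE, hypsubst) (simp add: ops A.imp_closed A.zero_closed flip: A.imp_eq)
  next
    case (12 x y) then show ?case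
      by (elim imageE, hypsubst) (simp add: ops A.imp_closed A.imp_imp_commute)
  qed (auto simp: ops A.imp_closed A.zero_closed A.mult_zero A.double_neg)
  moreover have "C \<in> mv_hom A Q"
    by (auto simp: mv_hom_def hom_def Q0 ops)
  moreover have "{a \<in> carrier A. h a = \<one>\<^bsub>B\<^esub>} = {a \<in> carrier A. C a = \<one>\<^bsub>Q\<^esub>}"
    using CC[OF _ A.one_closed] by (auto simp: Q0(1) h01(2))
  ultimately show ?thesis unfolding mv_filter_def by blast
qed

lemma topspace_mv_Spec_topology:
  assumes "mv_algebra A"
  shows "topspace (mv_Spec_topology A) = mv_Spec A"
proof -
  interpret mv_algebra A by fact
  have "\<bottom>\<^bsub>A\<^esub> \<notin> P" if "P \<in> mv_Spec A" for P
  proof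
    assume bot: "\<bottom>\<^bsub>A\<^esub> \<in> P"
    from that obtain B :: "'a set mv_alg" and h where B: "mv_algebra B" and h: "h \<in> mv_hom A B"
      and P: "P = {a \<in> carrier A. h a = \<one>\<^bsub>B\<^esub>}" and ne: "P \<noteq> carrier A"
      unfolding mv_Spec_def mv_filter_def by blast
    interpret B: mv_algebra B by fact
    have 0: "\<bottom>\<^bsub>B\<^esub> = \<one>\<^bsub>B\<^esub>" using bot P h by (auto simp: mv_hom_def)
    have "h a = \<one>\<^bsub>B\<^esub>" if "a \<in> carrier A" for a
    proof -
      have "h a \<in> carrier B" using h that by (auto simp: mv_hom_def hom_def)
      then show ?thesis using B.mult_zero[of "h a"] 0 by simp
    qed
    then show False using ne P by auto
  qed
  then show ?thesis
    unfolding mv_Spec_topology_def topology_generated_by_topspace using zero_closed by auto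
qed

lemma space_mv_Spec_borel [simp]: "space (mv_Spec_borel A) = mv_Spec A"
  by (simp add: mv_Spec_borel_def space_measure_of_conv)

abbreviation cube :: "(real ^ 'n) set" where
  "cube \<equiv> cbox 0 1"

text \<open>
  A continuous function is piecewise affine with finitely many integer pieces iff at each point it
  agrees with one of finitely many affine functions with integer coefficients. Functions on the
  cube are represented by extensional functions on \<open>real ^ 'n\<close>.
\<close>

definition McNaughton :: "(real ^ 'n \<Rightarrow> real) set" where
  "McNaughton = {t \<in> cube \<rightarrow>\<^sub>E {0..1}. continuous_on cube t \<and>
     (\<exists>L :: ((int ^ 'n) \<times> int) set. finite L \<and>
        (\<forall>p\<in>cube. \<exists>(a, c)\<in>L. t p = (\<Sum>i\<in>UNIV. of_int (a $ i) * p $ i) + of_int c))}"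

definition Free_MV :: "(real ^ 'n \<Rightarrow> real) mv_alg" where
  "Free_MV = \<lparr>carrier = McNaughton,
     mult = (\<lambda>a b. \<lambda>p\<in>cube. max 0 (a p + b p - 1)), one = (\<lambda>p\<in>cube. 1),
     mv_imp = (\<lambda>a b. \<lambda>p\<in>cube. min 1 (1 - a p + b p)), mv_zero = (\<lambda>p\<in>cube. 0)\<rparr>"

definition gen :: "'n \<Rightarrow> real ^ 'n \<Rightarrow> real" where
  "gen i = (\<lambda>p\<in>cube. p $ i)"

definition dual_map ::
    "((real ^ 'n \<Rightarrow> real) \<Rightarrow> (real ^ 'n \<Rightarrow> real)) \<Rightarrow> real ^ 'n \<Rightarrow> real ^ 'n" where
  "dual_map \<sigma> p = (\<chi> i. \<sigma> (gen i) p)"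

definition point_filter :: "real ^ 'n \<Rightarrow> (real ^ 'n \<Rightarrow> real) set" where
  "point_filter p = {t \<in> McNaughton. t p = 1}"

definition cube_measure :: "(real ^ 'n) measure" where
  "cube_measure = restrict_space lborel cube"

definition Spec_measure :: "(real ^ 'n \<Rightarrow> real) set measure" where
  "Spec_measure = distr cube_measure (mv_Spec_borel Free_MV) point_filter"

definition nonsingular :: "'a measure \<Rightarrow> ('a \<Rightarrow> 'a) \<Rightarrow> bool" where
  "nonsingular M T \<longleftrightarrow> T \<in> measurable M M \<and>
     (\<forall>A\<in>sets M. emeasure M A = 0 \<longrightarrow> emeasure M (T -` A \<inter> space M) = 0)"

definition isomorphic_under ::
    "'a measure \<Rightarrow> ('a \<Rightarrow> 'a) \<Rightarrow> 'b measure \<Rightarrow> ('b \<Rightarrow> 'b) \<Rightarrow> ('a \<Rightarrow> 'b) \<Rightarrow> bool" where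
  "isomorphic_under M T N U \<phi> \<longleftrightarrow> (\<exists>A\<in>sets M. \<exists>B\<in>sets N.
     space M - A \<in> null_sets M \<and> space N - B \<in> null_sets N \<and>
     T ` A \<subseteq> A \<and> U ` B \<subseteq> B \<and>
     bij_betw \<phi> A B \<and>
     \<phi> \<in> measurable (restrict_space M A) (restrict_space N B) \<and>
     the_inv_into A \<phi> \<in> measurable (restrict_space N B) (restrict_space M A) \<and>
     (\<forall>E\<in>sets (restrict_space N B). emeasure M (\<phi> -` E \<inter> A) = emeasure N E) \<and>
     (\<forall>x\<in>A. \<phi> (T x) = U (\<phi> x)))"

definition aff :: "(int ^ 'n) \<times> int \<Rightarrow> real ^ 'n \<Rightarrow> real" where
  "aff l p = (\<Sum>i\<in>UNIV. of_int (fst l $ i) * p $ i) + of_int (snd l)"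

lemma aff_simps: "aff 0 p = 0" "aff (0, 1) p = 1"
  "aff (l + m) p = aff l p + aff m p" "aff (l - m) p = aff l p - aff m p"
  by (simp_all add: aff_def algebra_simps sum.distrib sum_subtractf)

lemma McNaughton_iff:
  "t \<in> McNaughton \<longleftrightarrow> t \<in> extensional cube \<and> (\<forall>p\<in>cube. 0 \<le> t p \<and> t p \<le> 1) \<and>
     continuous_on cube t \<and> (\<exists>L. finite L \<and> (\<forall>p\<in>cube. \<exists>l\<in>L. t p = aff l p))"
  by (auto simp: McNaughton_def aff_def PiE_iff case_prod_beta)

lemma McNaughton_const: "(\<lambda>p\<in>cube. 0) \<in> McNaughton" "(\<lambda>p\<in>cube. 1) \<in> McNaughton"
proof -
  have "\<exists>L. finite L \<and> (\<forall>p\<in>cube. \<exists>l\<in>L. (0::real) = aff l p)"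
    by (rule exI[of _ "{0}"]) (simp add: aff_simps)
  then show "(\<lambda>p\<in>cube. 0) \<in> McNaughton"
    by (simp add: McNaughton_iff cong: continuous_on_cong_simp)
  have "\<exists>L. finite L \<and> (\<forall>p\<in>cube. \<exists>l\<in>L. (1::real) = aff l p)"
    by (rule exI[of _ "{(0,1)}"]) (simp add: aff_simps)
  then show "(\<lambda>p\<in>cube. 1) \<in> McNaughton"
    by (simp add: McNaughton_iff cong: continuous_on_cong_simp)
qed

lemma McNaughton_binop:
  assumes a: "a \<in> McNaughton" and b: "b \<in> McNaughton"
    and f: "continuous_on cube (\<lambda>p. f (a p) (b p))"
    and bd: "\<And>x y. \<lbrakk>0 \<le> x; x \<le> 1; 0 \<le> y; y \<le> 1\<rbrakk> \<Longrightarrow> 0 \<le> f x y \<and> f x y \<le> (1::real)"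
    and g: "finite (G :: (((int ^ 'n) \<times> int) \<Rightarrow> ((int ^ 'n) \<times> int) \<Rightarrow> ((int ^ 'n) \<times> int)) set)"
      "\<And>x y. \<exists>g\<in>G. \<forall>l m p. x = aff l p \<longrightarrow> y = aff m p \<longrightarrow> f x y = aff (g l m) p"
  shows "(\<lambda>p\<in>cube. f (a p) (b p)) \<in> (McNaughton :: (real ^ 'n \<Rightarrow> real) set)"
proof -
  from a obtain L where L: "finite L" "\<And>p. p \<in> cube \<Longrightarrow> \<exists>l\<in>L. a p = aff l p"
    unfolding McNaughton_iff by blast
  from b obtain M where M: "finite M" "\<And>p. p \<in> cube \<Longrightarrow> \<exists>l\<in>M. b p = aff l p"
    unfolding McNaughton_iff by blast
  let ?L = "(\<lambda>(g,l,m). g l m) ` (G \<times> L \<times> M)"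
  have "finite ?L" using L(1) M(1) g(1) by blast
  moreover have "\<exists>l\<in>?L. f (a p) (b p) = aff l p" if p: "p \<in> cube" for p
  proof -
    from L(2)[OF p] obtain l where l: "l \<in> L" "a p = aff l p" by blast
    from M(2)[OF p] obtain m where m: "m \<in> M" "b p = aff m p" by blast
    from g(2)[of "a p" "b p"] obtain k where "k \<in> G" "f (a p) (b p) = aff (k l m) p"
      using l m by metis
    then show ?thesis using l m by force
  qed
  ultimately have "\<exists>L. finite L \<and> (\<forall>p\<in>cube. \<exists>l\<in>L. f (a p) (b p) = aff l p)" by blast
  moreover have "continuous_on cube (\<lambda>p\<in>cube. f (a p) (b p))"
    using f by (simp cong: continuous_on_cong_simp)
  ultimately show ?thesis
    using a b bd by (auto simp: McNaughton_iff)
qed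

lemma McNaughton_cont: "a \<in> McNaughton \<Longrightarrow> continuous_on cube a"
  by (simp add: McNaughton_iff)

lemma McNaughton_mult:
  assumes "a \<in> McNaughton" "b \<in> McNaughton"
  shows "(\<lambda>p\<in>cube. max 0 (a p + b p - 1)) \<in> McNaughton"
proof (rule McNaughton_binop[where f = "\<lambda>x y. max 0 (x + y - 1)"
      and G = "{\<lambda>l m. 0, \<lambda>l m. l + m - (0,1)}", OF assms])
  show "continuous_on cube (\<lambda>p. max 0 (a p + b p - 1))"
    by (intro continuous_intros McNaughton_cont assms)
  show "\<exists>g\<in>{\<lambda>l m. 0, \<lambda>l m. l + m - (0, 1)}. \<forall>l m p. x = aff l p \<longrightarrow> y = aff m p \<longrightarrow>
      max 0 (x + y - 1) = aff (g l m) p" for x y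
    by (cases "x + y \<le> 1") (simp_all add: aff_simps max_def del: split_paired_All)
qed (auto simp: max_def)

lemma McNaughton_imp:
  assumes "a \<in> McNaughton" "b \<in> McNaughton"
  shows "(\<lambda>p\<in>cube. min 1 (1 - a p + b p)) \<in> McNaughton"
proof (rule McNaughton_binop[where f = "\<lambda>x y. min 1 (1 - x + y)"
      and G = "{\<lambda>l m. (0,1), \<lambda>l m. (0,1) - l + m}", OF assms])
  show "continuous_on cube (\<lambda>p. min 1 (1 - a p + b p))"
    by (intro continuous_intros McNaughton_cont assms)
  show "\<exists>g\<in>{\<lambda>l m. (0,1), \<lambda>l m. (0,1) - l + m}. \<forall>l m p. x = aff l p \<longrightarrow> y = aff m p \<longrightarrow>
      min 1 (1 - x + y) = aff (g l m) p" for x y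
    by (cases "x \<le> y") (simp_all add: aff_simps min_def del: split_paired_All)
qed (auto simp: min_def)

lemma McNaughton_eqI:
  assumes "a \<in> McNaughton" "b \<in> extensional cube" "\<And>p. \<lbrakk>p \<in> cube; 0 \<le> a p; a p \<le> 1\<rbrakk> \<Longrightarrow> b p = a p"
  shows "b = a"
  using assms by (intro extensionalityI[of _ cube]) (auto simp: McNaughton_iff)

lemma McNaughton_range:
  assumes "a \<in> McNaughton" "p \<in> cube" shows "0 \<le> a p" "a p \<le> 1"
  using assms by (auto simp: McNaughton_iff)

lemma gen_in_McNaughton: "gen (i :: 'n::finite) \<in> McNaughton"
proof -
  have "aff (axis i 1, 0) p = p $ i" for p :: "real ^ 'n"
    by (simp add: aff_def axis_def if_distrib[of real_of_int] if_distrib[of "\<lambda>x. x * _"] cong: if_cong)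
  then show ?thesis
    by (auto simp: McNaughton_iff gen_def mem_box_cart cong: continuous_on_cong_simp
          intro!: continuous_intros exI[of _ "{(axis i 1, 0)}"])
qed

lemma mv_algebra_Free_MV: "mv_algebra Free_MV"
proof (unfold_locales, goal_cases)
  case (1 x y) then show ?case by (simp add: Free_MV_def McNaughton_mult)
next
  case (2 x y z) then show ?case
    by (auto simp: Free_MV_def fun_eq_iff restrict_def dest!: McNaughton_range)
next
  case 3 then show ?case by (simp add: Free_MV_def McNaughton_const)
next
  case (4 x) then show ?case
    by (auto simp: Free_MV_def intro!: McNaughton_eqI[of x])
next
  case (5 x) then show ?case
    by (auto simp: Free_MV_def intro!: McNaughton_eqI[of x])
next
  case (6 x y) then show ?case
    by (auto simp: Free_MV_def fun_eq_iff restrict_def add.commute)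
next
  case 7 then show ?case by (simp add: Free_MV_def McNaughton_const)
next
  case (8 x y) then show ?case by (simp add: Free_MV_def McNaughton_imp)
next
  case (9 x) then show ?case
    by (auto simp: Free_MV_def fun_eq_iff restrict_def dest!: McNaughton_range)
next
  case (10 x) then show ?case
    by (auto simp: Free_MV_def intro!: McNaughton_eqI[of x])
next
  case (11 x y)
  then have "x p \<in> {0..1} \<and> y p \<in> {0..1}" if "p \<in> cube" for p
    using that by (simp add: Free_MV_def McNaughton_range)
  then show ?case
    by (fastforce simp: Free_MV_def fun_eq_iff restrict_def max_def min_def)
next
  case (12 x y)
  then have "x p \<in> {0..1} \<and> y p \<in> {0..1}" if "p \<in> cube" for p
    using that by (simp add: Free_MV_def McNaughton_range)
  then show ?case
    by (fastforce simp: Free_MV_def fun_eq_iff restrict_def max_def min_def)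
qed

lemma emeasure_cube: "emeasure lborel (cube :: (real ^ 'n) set) = 1"
proof -
  have "(1 :: real ^ 'n) \<bullet> b = 1" if "b \<in> Basis" for b
    using that by (auto simp: Basis_vec_def inner_axis)
  then show ?thesis by (simp add: emeasure_lborel_cbox_eq)
qed

lemma space_cube_measure [simp]: "space cube_measure = cube"
  by (simp add: cube_measure_def space_restrict_space)

lemma prob_space_cube_measure: "prob_space cube_measure"
proof
  show "emeasure cube_measure (space (cube_measure :: (real ^ 'n) measure)) = 1"
    by (simp add: emeasure_cube) (simp add: cube_measure_def emeasure_restrict_space emeasure_cube)
qed

lemma dual_map_cube:
  assumes "\<sigma> \<in> mv_hom Free_MV Free_MV" "p \<in> cube"
  shows "dual_map \<sigma> p \<in> cube"
proof -
  have "\<sigma> (gen i) \<in> McNaughton" for i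
    using assms(1) gen_in_McNaughton[of i] by (auto simp: mv_hom_def hom_def Free_MV_def)
  then show ?thesis
    using McNaughton_range[OF _ assms(2)] by (simp add: dual_map_def mem_box_cart)
qed

definition standard_MV :: "real mv_alg" where
  "standard_MV = \<lparr>carrier = {0..1}, mult = (\<lambda>a b. max 0 (a + b - 1)), one = 1,
     mv_imp = (\<lambda>a b. min 1 (1 - a + b)), mv_zero = 0\<rparr>"

lemma mv_algebra_standard_MV: "mv_algebra standard_MV"
  by unfold_locales (auto simp: standard_MV_def max_def min_def)

lemma eval_hom: "p \<in> cube \<Longrightarrow> (\<lambda>t. t p) \<in> mv_hom Free_MV standard_MV"
  by (auto simp: mv_hom_def hom_def Free_MV_def standard_MV_def McNaughton_range)

lemma point_filter_in_Spec:
  assumes p: "p \<in> cube"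
  shows "point_filter p \<in> mv_Spec Free_MV"
proof -
  have "mv_filter Free_MV (point_filter p)"
    using mv_filter_preimage[OF mv_algebra_Free_MV mv_algebra_standard_MV eval_hom[OF p]]
    by (simp add: point_filter_def Free_MV_def standard_MV_def)
  moreover have "(\<lambda>p\<in>cube. 0) \<in> carrier Free_MV" "(\<lambda>p\<in>cube. 0) \<notin> point_filter p"
    using p by (auto simp: Free_MV_def point_filter_def McNaughton_const)
  moreover have "mv_prime Free_MV (point_filter p)"
    using p by (auto simp: mv_prime_def Free_MV_def point_filter_def McNaughton_imp)
  ultimately show ?thesis unfolding mv_Spec_def by blast
qed

lemma point_filter_continuous:
  "continuous_map (top_of_set cube) (mv_Spec_topology Free_MV)
     (point_filter :: real ^ 'n \<Rightarrow> _)"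
  unfolding mv_Spec_topology_def
proof (rule continuous_on_generated_topo)
  fix U :: "(real ^ 'n \<Rightarrow> real) set set" assume "U \<in> {{P \<in> mv_Spec Free_MV. a \<notin> P} | a. a \<in> carrier Free_MV}"
  then obtain a where a: "a \<in> McNaughton" and U: "U = {P \<in> mv_Spec Free_MV. a \<notin> P}"
    by (auto simp: Free_MV_def)
  have "point_filter -` U \<inter> cube = cube \<inter> a -` (- {1})"
    using a point_filter_in_Spec by (auto simp: U point_filter_def)
  moreover have "openin (top_of_set cube) (cube \<inter> a -` (- {1}))"
    by (rule continuous_openin_preimage_gen[OF McNaughton_cont[OF a]]) (simp add: open_Compl)
  ultimately show "openin (top_of_set cube) (point_filter -` U \<inter> topspace (top_of_set cube))"
    by simp
next
  show "point_filter ` topspace (top_of_set cube) \<subseteq>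
      \<Union> {{P \<in> mv_Spec Free_MV. a \<notin> P} | a. a \<in> carrier Free_MV}"
    using topspace_mv_Spec_topology[OF mv_algebra_Free_MV] point_filter_in_Spec
    unfolding mv_Spec_topology_def topology_generated_by_topspace by simp blast
qed

lemma point_filter_measurable:
  "(point_filter :: real ^ 'n \<Rightarrow> _) \<in> measurable cube_measure (mv_Spec_borel Free_MV)"
  unfolding mv_Spec_borel_def
proof (rule measurable_measure_of)
  show "{U. openin (mv_Spec_topology Free_MV) U} \<subseteq> Pow (mv_Spec Free_MV)"
    using topspace_mv_Spec_topology[OF mv_algebra_Free_MV] openin_subset by blast
  show "point_filter \<in> space cube_measure \<rightarrow> mv_Spec Free_MV"
    using point_filter_in_Spec by auto
  fix U :: "(real ^ 'n \<Rightarrow> real) set set" assume "U \<in> {U. openin (mv_Spec_topology Free_MV) U}"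
  then have "openin (top_of_set cube) (cube \<inter> point_filter -` U)"
    using point_filter_continuous
    by (auto simp: continuous_map_def vimage_def Int_def)
  then obtain V where "open V" "cube \<inter> point_filter -` U = cube \<inter> V"
    by (auto simp: openin_open)
  then show "point_filter -` U \<inter> space cube_measure \<in> sets cube_measure"
    by (auto simp: cube_measure_def sets_restrict_space space_restrict_space Int_commute)
qed

lemma emeasure_Spec_measure:
  assumes "A \<in> sets (mv_Spec_borel Free_MV)"
  shows "emeasure Spec_measure A = emeasure lborel (point_filter -` A \<inter> cube)"
proof -
  have "point_filter -` A \<inter> cube \<in> sets cube_measure"
    using measurable_sets[OF point_filter_measurable assms] by simp
  then show ?thesis
    unfolding Spec_measure_def emeasure_distr[OF point_filter_measurable assms]
    by (simp add: cube_measure_def emeasure_restrict_space sets_restrict_space)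
qed

lemma prob_space_Spec_measure: "prob_space Spec_measure"
  unfolding Spec_measure_def
  by (rule prob_space.prob_space_distr[OF prob_space_cube_measure point_filter_measurable])

end

theory Submission
  imports Defs
begin

text \<open>
  By compactness of the cube every proper filter lies in some \<open>\<pi>(p)\<close>; applied to the filter
  \<open>\<sigma>\<^sup>-\<^sup>1[\<pi>(p)]\<close> this gives \<open>\<sigma>(t) = t \<circ> s\<close> with \<open>s\<close> the dual map, without using that the
  coordinate functions generate. Hence \<open>\<pi> \<circ> s = S \<circ> \<pi>\<close> on the whole cube, and one can take
  \<open>A\<^sub>1\<close> to be the cube and \<open>A\<^sub>2\<close> its image \<open>\<pi>[A\<^sub>1]\<close>. A filter that contains the truncations of all integer
  affine functions with value at least 1 at \<open>p\<close> contains \<open>\<pi>(p)\<close>, so \<open>A\<^sub>2\<close> is cut out of \<open>X\<close>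
  by countably many conditions and is Borel. Truncated affine functions also separate points from
  closed sets, so every Borel subset of the cube is the preimage under \<open>\<pi>\<close> of a Borel subset of \<open>X\<close>.
\<close>

lemma carrier_Free_MV: "carrier Free_MV = McNaughton"
  by (simp add: Free_MV_def)

lemma Free_MV_const: "\<bottom>\<^bsub>Free_MV\<^esub> = (\<lambda>p\<in>cube. 0)" "\<one>\<^bsub>Free_MV\<^esub> = (\<lambda>p\<in>cube. 1)"
  by (simp_all add: Free_MV_def)

subsection \<open>Filters\<close>

text \<open>Since \<open>h a = 1\<close>, the hypothesis becomes
  \<open>1 \<leadsto> h b = 1\<close>, and \<open>1 \<leadsto> y = y\<close> in the target. This is
  upward closure for the natural order.\<close>

lemma mv_filter_imp_closed:
  assumes "mv_algebra A" "mv_filter A F" "a \<in> F" "b \<in> carrier A" "a \<leadsto>\<^bsub>A\<^esub> b = \<one>\<^bsub>A\<^esub>"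
  shows "b \<in> F"
proof -
  from assms(2) obtain B :: "'a set mv_alg" and h where B: "mv_algebra B" and h: "h \<in> mv_hom A B"
    and F: "F = {a \<in> carrier A. h a = \<one>\<^bsub>B\<^esub>}"
    unfolding mv_filter_def by blast
  interpret B: mv_algebra B by fact
  have hb: "h b \<in> carrier B" using h assms(4) by (auto simp: mv_hom_def hom_def)
  have "\<one>\<^bsub>B\<^esub> = h (a \<leadsto>\<^bsub>A\<^esub> b)" using h assms(5) by (simp add: mv_hom_def)
  also have "\<dots> = \<one>\<^bsub>B\<^esub> \<leadsto>\<^bsub>B\<^esub> h b" using h assms(3,4) by (simp add: mv_hom_def F)
  also have "\<dots> = h b"
    using B.imp_eq[OF B.one_closed hb] hb by (simp add: B.imp_closed B.zero_closed B.double_neg)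
  finally show ?thesis using assms(4) by (simp add: F)
qed

lemma mv_filter_one: "mv_algebra A \<Longrightarrow> mv_filter A F \<Longrightarrow> \<one>\<^bsub>A\<^esub> \<in> F"
  by (auto simp: mv_filter_def mv_hom_def mv_algebra_def comm_monoid_def intro: monoid.one_closed)

lemma mv_filter_mult:
  assumes "mv_algebra A" "mv_filter A F" "a \<in> F" "b \<in> F"
  shows "a \<otimes>\<^bsub>A\<^esub> b \<in> F"
proof -
  interpret A: mv_algebra A by fact
  from assms(2) obtain B :: "'a set mv_alg" and h where B: "mv_algebra B" and h: "h \<in> mv_hom A B"
    and F: "F = {a \<in> carrier A. h a = \<one>\<^bsub>B\<^esub>}"
    unfolding mv_filter_def by blast
  interpret B: mv_algebra B by fact
  show ?thesis using h assms(3,4) by (auto simp: F mv_hom_def hom_def)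
qed

lemma mv_filter_zero_notin:
  fixes A :: "'a mv_alg"
  assumes "mv_algebra A" "mv_filter A F" "F \<noteq> carrier A"
  shows "\<bottom>\<^bsub>A\<^esub> \<notin> F"
proof
  assume bot: "\<bottom>\<^bsub>A\<^esub> \<in> F"
  interpret A: mv_algebra A by fact
  \<comment> \<open>The chain is \<open>1 \<leadsto> \<bottom> = \<bottom>\<close>, so
    \<open>\<bottom> \<leadsto> \<bottom> = 1\<close> by double negation, so
    \<open>\<bottom> \<leadsto> a = 1\<close> because products with \<open>\<bottom>\<close>
    vanish.\<close>
  have "a \<in> F" if "a \<in> carrier A" for a
  proof (rule mv_filter_imp_closed[OF assms(1,2) bot that])
    have "\<one>\<^bsub>A\<^esub> \<leadsto>\<^bsub>A\<^esub> \<bottom>\<^bsub>A\<^esub> = \<bottom>\<^bsub>A\<^esub>"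
      using A.imp_eq[OF A.one_closed A.zero_closed] A.double_neg[OF A.zero_closed]
        A.l_one[OF A.imp_closed[OF A.zero_closed A.zero_closed]] by metis
    then have "\<bottom>\<^bsub>A\<^esub> \<leadsto>\<^bsub>A\<^esub> \<bottom>\<^bsub>A\<^esub> = \<one>\<^bsub>A\<^esub>"
      using A.double_neg[OF A.one_closed] by metis
    then show "\<bottom>\<^bsub>A\<^esub> \<leadsto>\<^bsub>A\<^esub> a = \<one>\<^bsub>A\<^esub>"
      using A.imp_eq[OF A.zero_closed that] A.imp_closed[OF that A.zero_closed]
        A.mult_zero A.m_comm A.zero_closed by metis
  qed
  moreover have "F \<subseteq> carrier A" using assms(2) by (auto simp: mv_filter_def)
  ultimately show False using assms(3) by blast
qed

lemma mv_filter_subset_carrier: "mv_filter A F \<Longrightarrow> F \<subseteq> carrier A"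
  by (auto simp: mv_filter_def)

lemma Free_MV_filter_mono:
  assumes "mv_filter Free_MV F" "u \<in> F" "a \<in> McNaughton" "\<And>p. p \<in> cube \<Longrightarrow> u p \<le> a p"
  shows "a \<in> F"
  using assms(3,4)
  by (intro mv_filter_imp_closed[OF mv_algebra_Free_MV assms(1,2)])
    (auto simp: Free_MV_def fun_eq_iff restrict_def)

text \<open>A product lies below each of its factors, so the product of finitely many members of
  \<open>F\<close> serves as the bound.\<close>

lemma Free_MV_filter_finite_lower:
  assumes F: "mv_filter Free_MV F" and "finite T" "T \<subseteq> F"
  shows "\<exists>u\<in>F. \<forall>t\<in>T. \<forall>p\<in>cube. u p \<le> t p"
  using assms(2,3)
proof (induction T rule: finite_induct)
  case empty
  then show ?case using mv_filter_one[OF mv_algebra_Free_MV F] by auto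
next
  case (insert t T)
  then obtain u where u: "u \<in> F" "\<forall>t\<in>T. \<forall>p\<in>cube. u p \<le> t p" by auto
  have t: "t \<in> F" using insert.prems by simp
  let ?v = "u \<otimes>\<^bsub>Free_MV\<^esub> t"
  have "?v p \<le> u p \<and> ?v p \<le> t p" if "p \<in> cube" for p
  proof -
    have "u \<in> McNaughton" "t \<in> McNaughton"
      using t u(1) mv_filter_subset_carrier[OF F] by (auto simp: carrier_Free_MV)
    from McNaughton_range[OF this(1) that] McNaughton_range[OF this(2) that] that
    show ?thesis by (auto simp: Free_MV_def)
  qed
  moreover have "?v \<in> F" using mv_filter_mult[OF mv_algebra_Free_MV F] u t by blast
  ultimately show ?case using u(2) by (intro bexI[of _ ?v]) (auto intro: order_trans)
qed

text \<open>This is the \<open>k\<close>-th power of \<open>t\<close>: each further factor subtracts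
  \<open>1 - t\<close>, and an earlier truncation at 0 does no harm since
  \<open>1 - t \<ge> 0\<close>.\<close>

lemma Free_MV_power_closed:
  assumes F: "mv_filter Free_MV F" and t: "t \<in> F"
  shows "(\<lambda>p\<in>cube. max 0 (1 - real k * (1 - t p))) \<in> F"
proof (induction k)
  case 0
  then show ?case using mv_filter_one[OF mv_algebra_Free_MV F] by (simp add: Free_MV_def restrict_def)
next
  case (Suc k)
  have tM: "t \<in> McNaughton"
    using t mv_filter_subset_carrier[OF F] by (auto simp: carrier_Free_MV)
  have "(\<lambda>p\<in>cube. max 0 (1 - real (Suc k) * (1 - t p))) =
    (\<lambda>p\<in>cube. max 0 (1 - real k * (1 - t p))) \<otimes>\<^bsub>Free_MV\<^esub> t"
    using McNaughton_range[OF tM] by (fastforce simp: Free_MV_def fun_eq_iff restrict_def algebra_simps max_def)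
  then show ?case using mv_filter_mult[OF mv_algebra_Free_MV F Suc t] by metis
qed

text \<open>Otherwise the maximum of \<open>t\<close> over the compact cube is below 1, and a
  sufficiently high power of \<open>t\<close> vanishes identically, which puts
  \<open>\<bottom>\<close> into \<open>F\<close>.\<close>

lemma Free_MV_proper_filter_attains_one:
  fixes t :: "real ^ 'n \<Rightarrow> real"
  assumes F: "mv_filter Free_MV F" and ne: "F \<noteq> McNaughton" and t: "t \<in> F"
  shows "\<exists>p\<in>cube. t p = 1"
proof (rule ccontr)
  assume no: "\<not> (\<exists>p\<in>cube. t p = 1)"
  have tM: "t \<in> McNaughton"
    using t mv_filter_subset_carrier[OF F] by (auto simp: carrier_Free_MV)
  have "cube \<noteq> ({} :: (real ^ 'n) set)" 
    by (simp add: interval_ne_empty_cart)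
  then obtain q where q: "q \<in> cube" "\<And>p. p \<in> cube \<Longrightarrow> t p \<le> t q"
    using continuous_attains_sup[OF compact_cbox _ McNaughton_cont[OF tM]] by blast
  have "t q < 1" using no q(1) McNaughton_range[OF tM q(1)] by force
  then obtain k :: nat where k: "1 < real k * (1 - t q)"
    using reals_Archimedean3[of "1 - t q"] by force
  have "(\<lambda>p\<in>cube. max 0 (1 - real k * (1 - t p))) = (\<lambda>p\<in>cube. 0)"
  proof (intro restrict_ext)
    fix p :: "real ^ 'n" assume "p \<in> cube"
    then have "real k * (1 - t q) \<le> real k * (1 - t p)" using q(2) by (intro mult_left_mono) auto
    then show "max 0 (1 - real k * (1 - t p)) = 0" using k by simp
  qed
  then have "\<bottom>\<^bsub>Free_MV\<^esub> \<in> F" using Free_MV_power_closed[OF F t, of k] by (simp add: Free_MV_def)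
  then show False using mv_filter_zero_notin[OF mv_algebra_Free_MV F] ne by (simp add: carrier_Free_MV)
qed

text \<open>The sets where members of \<open>F\<close> equal 1 are closed in the compact cube. A
  common lower bound attains 1, which gives the finite intersection property; any point of the total
  intersection is suitable.\<close>

lemma Free_MV_proper_filter_subset_point_filter:
  assumes F: "mv_filter Free_MV F" and ne: "F \<noteq> McNaughton"
  shows "\<exists>p\<in>cube. F \<subseteq> point_filter p"
proof -
  have M: "t \<in> McNaughton" if "t \<in> F" for t
    using that mv_filter_subset_carrier[OF F] by (auto simp: carrier_Free_MV)
  let ?Z = "\<lambda>t :: real ^ 'n \<Rightarrow> real. cube \<inter> t -` {1}"
  have "cube \<inter> (\<Inter>t\<in>F. ?Z t) \<noteq> {}"
  proof (rule compact_imp_fip_image)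
    fix t assume "t \<in> F"
    then show "closed (?Z t)"
      using McNaughton_cont[OF M] by (intro continuous_closed_preimage) auto
  next
    fix T assume "finite T" "T \<subseteq> F"
    from Free_MV_filter_finite_lower[OF F this] obtain u
      where u: "u \<in> F" "\<forall>t\<in>T. \<forall>p\<in>cube. u p \<le> t p" by blast
    from Free_MV_proper_filter_attains_one[OF F ne u(1)] obtain p where p: "p \<in> cube" "u p = 1"
      by blast
    have "t p = 1" if "t \<in> T" for t
      using that u(2) p McNaughton_range(2)[OF M p(1), of t] \<open>T \<subseteq> F\<close> by force
    then show "cube \<inter> (\<Inter>t\<in>T. ?Z t) \<noteq> {}" using p(1) by blast
  qed simp
  then obtain p where "p \<in> cube" "\<forall>t\<in>F. t p = 1" by (force split: if_splits)
  then show ?thesis using M by (auto simp: point_filter_def)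
qed

subsection \<open>Homomorphisms and evaluations\<close>

definition clip :: "real \<Rightarrow> real" where
  "clip x = max 0 (min 1 x)"

lemma clip_range: "0 \<le> clip x" "clip x \<le> 1"
  by (auto simp: clip_def)

lemma clip_eq_1_iff: "clip x = 1 \<longleftrightarrow> 1 \<le> x"
  by (auto simp: clip_def)

text \<open>
  The identity \<open>clip (y + x) = (clip y \<oplus> x) \<otimes> clip (y + 1)\<close> for \<open>x \<in> {0..1}\<close> reduces the
  coefficient of \<open>t\<close>.
\<close>

lemma hom_clip:
  fixes \<sigma> :: "(real ^ 'n \<Rightarrow> real) \<Rightarrow> (real ^ 'n \<Rightarrow> real)"
  assumes \<sigma>: "\<sigma> \<in> mv_hom Free_MV Free_MV" and t: "t \<in> McNaughton"
  shows "(\<lambda>p\<in>cube. clip (of_int m + real k * t p)) \<in> McNaughton \<and>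
    \<sigma> (\<lambda>p\<in>cube. clip (of_int m + real k * t p)) = (\<lambda>p\<in>cube. clip (of_int m + real k * \<sigma> t p))"
\<comment> \<open>The step uses the claim for \<open>k\<close> at both \<open>m\<close> and
  \<open>m + 1\<close>, so \<open>m\<close> must vary.\<close>
proof (induction k arbitrary: m)
  case 0
  show ?case
  proof (cases "m \<ge> 1")
    case True
    then have c: "clip (of_int m) = 1" by (simp add: clip_eq_1_iff)
    then show ?thesis using \<sigma> McNaughton_const by (simp add: c mv_hom_def flip: Free_MV_const)
  next
    case False
    then have c: "clip (of_int m) = 0" by (simp add: clip_def)
    then show ?thesis using \<sigma> McNaughton_const by (simp add: c mv_hom_def flip: Free_MV_const)
  qed
next
  case (Suc k)
  let ?g = "\<lambda>m k t. (\<lambda>p\<in>cube. clip (of_int m + real k * t p)) :: real ^ 'n \<Rightarrow> real"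
  have st: "\<sigma> t \<in> McNaughton"
    using \<sigma> t by (auto simp: mv_hom_def hom_def carrier_Free_MV)
  have step: "?g m (Suc k) u =
    ((?g m k u \<leadsto>\<^bsub>Free_MV\<^esub> \<bottom>\<^bsub>Free_MV\<^esub>) \<leadsto>\<^bsub>Free_MV\<^esub> u) \<otimes>\<^bsub>Free_MV\<^esub> ?g (m + 1) k u"
    if u: "u \<in> McNaughton" for u
  proof -
    have "clip (y + x) = max 0 (min 1 (1 - min 1 (1 - clip y + 0) + x) + clip (y + 1) - 1)"
      if "0 \<le> x" "x \<le> 1" for x y
      using that by (auto simp: clip_def max_def min_def)
    from this[of "u p" "of_int m + real k * u p" for p] McNaughton_range[OF u]
    show ?thesis
      by (auto simp: Free_MV_def fun_eq_iff restrict_def algebra_simps)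
  qed
  interpret A: mv_algebra "Free_MV :: (real ^ 'n \<Rightarrow> real) mv_alg" by (rule mv_algebra_Free_MV)
  have IH: "\<sigma> (?g m k t) = ?g m k (\<sigma> t)" for m using Suc by metis
  have c: "?g m k t \<in> carrier Free_MV" for m using Suc carrier_Free_MV by metis
  have t': "t \<in> carrier Free_MV" using t by (simp add: carrier_Free_MV)
  note cl = A.imp_closed A.zero_closed c t' A.m_closed
  have "?g m (Suc k) t \<in> carrier Free_MV"
    unfolding step[OF t] by (intro cl)
  moreover have "\<sigma> (?g m (Suc k) t) = ?g m (Suc k) (\<sigma> t)"
  proof -
    have h: "\<sigma> (x \<otimes>\<^bsub>Free_MV\<^esub> y) = \<sigma> x \<otimes>\<^bsub>Free_MV\<^esub> \<sigma> y"
        "\<sigma> (x \<leadsto>\<^bsub>Free_MV\<^esub> y) = \<sigma> x \<leadsto>\<^bsub>Free_MV\<^esub> \<sigma> y"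
      if "x \<in> carrier Free_MV" "y \<in> carrier Free_MV" for x y
      using \<sigma> that by (auto simp: mv_hom_def hom_def)
    have h0: "\<sigma> \<bottom>\<^bsub>Free_MV\<^esub> = \<bottom>\<^bsub>Free_MV\<^esub>" using \<sigma> by (simp add: mv_hom_def)
    show ?thesis
      unfolding step[OF t] step[OF st] by (simp only: h h0 cl IH)
  qed
  ultimately show ?case unfolding carrier_Free_MV by blast
qed

text \<open>Composing a homomorphism that defines \<open>P\<close> with \<open>\<sigma>\<close>
  gives one that defines the preimage; properness survives because \<open>\<sigma>\<close> preserves
  \<open>\<bottom>\<close>.\<close>

lemma Spec_map_in_Spec:
  assumes \<sigma>: "\<sigma> \<in> mv_hom A A" and A: "mv_algebra A" and P: "P \<in> mv_Spec A"
  shows "Spec_map A \<sigma> P \<in> mv_Spec A"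
proof -
  interpret A: mv_algebra A by fact
  have c: "\<sigma> a \<in> carrier A" if "a \<in> carrier A" for a
    using \<sigma> that by (auto simp: mv_hom_def hom_def)
  have Pf: "mv_filter A P" "P \<noteq> carrier A" "mv_prime A P" using P by (auto simp: mv_Spec_def)
  from Pf(1) obtain B :: "'a set mv_alg" and h where B: "mv_algebra B" and h: "h \<in> mv_hom A B"
    and Ph: "P = {a \<in> carrier A. h a = \<one>\<^bsub>B\<^esub>}"
    unfolding mv_filter_def by blast
  have "h \<circ> \<sigma> \<in> mv_hom A B"
    using h \<sigma> c by (auto simp: mv_hom_def hom_def)
  moreover have "Spec_map A \<sigma> P = {a \<in> carrier A. (h \<circ> \<sigma>) a = \<one>\<^bsub>B\<^esub>}"
    using c by (auto simp: Spec_map_def Ph)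
  ultimately have "mv_filter A (Spec_map A \<sigma> P)" using B unfolding mv_filter_def by blast
  moreover have "\<bottom>\<^bsub>A\<^esub> \<notin> Spec_map A \<sigma> P"
    using mv_filter_zero_notin[OF A Pf(1,2)] \<sigma> by (simp add: Spec_map_def mv_hom_def)
  moreover have "mv_prime A (Spec_map A \<sigma> P)"
    using Pf(3) c \<sigma> A.imp_closed by (simp add: mv_prime_def Spec_map_def mv_hom_def)
  ultimately show ?thesis using A.zero_closed by (auto simp: mv_Spec_def)
qed

text \<open>If \<open>y\<close> exceeded \<open>z\<close>, some \<open>k\<close> would stretch the
  gap beyond 1, and the integer offset \<open>1 - \<lfloor>k * y\<rfloor>\<close> would separate the
  two.\<close>

lemma real_le_of_floor_mult:
  fixes y z :: real
  assumes "\<And>k::nat. \<And>m::int. 1 \<le> of_int m + real k * y \<Longrightarrow> 1 \<le> of_int m + real k * z"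
  shows "y \<le> z"
proof (rule ccontr)
  assume "\<not> y \<le> z"
  then obtain k :: nat where k: "1 < real k * (y - z)"
    using reals_Archimedean3[of "y - z"] by force
  have "1 \<le> of_int (1 - \<lfloor>real k * y\<rfloor>) + real k * y" by simp
  from assms[OF this] have "of_int \<lfloor>real k * y\<rfloor> \<le> real k * z" by simp
  then show False using k by (simp add: algebra_simps) linarith
qed

text \<open>The preimage of the point filter at \<open>p\<close> lies in the point filter at some
  \<open>q\<close>. Truncations of \<open>m + k * t\<close> carry thresholds along this inclusion,
  giving \<open>\<sigma> t p \<le> t q\<close>; the negation of \<open>t\<close> supplies the
  reverse inequality.\<close>

lemma endomorphism_eq_composition:
  fixes \<sigma> :: "(real ^ 'n \<Rightarrow> real) \<Rightarrow> (real ^ 'n \<Rightarrow> real)"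
  assumes \<sigma>: "\<sigma> \<in> mv_hom Free_MV Free_MV" and p: "p \<in> cube" and t: "t \<in> McNaughton"
  shows "\<sigma> t p = t (dual_map \<sigma> p)"
proof -
  let ?F = "Spec_map Free_MV \<sigma> (point_filter p)"
  have "?F \<in> mv_Spec Free_MV"
    by (rule Spec_map_in_Spec[OF \<sigma> mv_algebra_Free_MV point_filter_in_Spec[OF p]])
  then obtain q where q: "q \<in> cube" "?F \<subseteq> point_filter q"
    using Free_MV_proper_filter_subset_point_filter[of ?F] by (auto simp: mv_Spec_def carrier_Free_MV)
  have s: "\<sigma> t \<in> McNaughton" if "t \<in> McNaughton" for t
    using \<sigma> that by (auto simp: mv_hom_def hom_def carrier_Free_MV)
  have le: "\<sigma> t p \<le> t q" if t: "t \<in> McNaughton" for t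
  proof (rule real_le_of_floor_mult)
    fix k :: nat and m :: int assume 1: "1 \<le> of_int m + real k * \<sigma> t p"
    let ?g = "\<lambda>p\<in>cube. clip (of_int m + real k * t p)"
    have "?g \<in> ?F"
      using hom_clip[OF \<sigma> t, of m k] s[of ?g] 1 p
      by (simp add: Spec_map_def point_filter_def carrier_Free_MV clip_eq_1_iff)
    then have "?g q = 1" using q(2) by (auto simp: point_filter_def)
    then show "1 \<le> of_int m + real k * t q" using q(1) by (simp add: clip_eq_1_iff)
  qed
  have eq: "\<sigma> t p = t q" if t: "t \<in> McNaughton" for t
  proof -
    let ?n = "t \<leadsto>\<^bsub>Free_MV\<^esub> \<bottom>\<^bsub>Free_MV\<^esub>"
    interpret A: mv_algebra "Free_MV :: (real ^ 'n \<Rightarrow> real) mv_alg" by (rule mv_algebra_Free_MV)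
    have "?n \<in> McNaughton" using A.imp_closed A.zero_closed t by (simp add: carrier_Free_MV)
    from le[OF this] have "\<sigma> ?n p \<le> ?n q" .
    moreover have "\<sigma> ?n = \<sigma> t \<leadsto>\<^bsub>Free_MV\<^esub> \<bottom>\<^bsub>Free_MV\<^esub>"
      using \<sigma> t A.zero_closed by (simp add: mv_hom_def carrier_Free_MV)
    ultimately have "1 - \<sigma> t p \<le> 1 - t q"
      using p q(1) McNaughton_range[OF t q(1)] McNaughton_range[OF s[OF t] p]
      by (simp add: Free_MV_def)
    then show ?thesis using le[OF t] by simp
  qed
  \<comment> \<open>Evaluating the equality on the coordinate functions identifies
    \<open>q\<close>.\<close>
  have "dual_map \<sigma> p = q"
    using eq[OF gen_in_McNaughton] q(1) by (simp add: dual_map_def gen_def vec_eq_iff)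
  then show ?thesis using eq[OF t] by simp
qed

text \<open>The conjugacy of the two systems: both sides consist of the \<open>t\<close> whose
  composite with the dual map is 1 at \<open>p\<close>.\<close>

lemma Spec_map_point_filter:
  fixes \<sigma> :: "(real ^ 'n \<Rightarrow> real) \<Rightarrow> (real ^ 'n \<Rightarrow> real)"
  assumes \<sigma>: "\<sigma> \<in> mv_hom Free_MV Free_MV" and p: "p \<in> cube"
  shows "Spec_map Free_MV \<sigma> (point_filter p) = point_filter (dual_map \<sigma> p)"
proof -
  have "\<sigma> t \<in> McNaughton" if "t \<in> McNaughton" for t
    using \<sigma> that by (auto simp: mv_hom_def hom_def carrier_Free_MV)
  then show ?thesis
    using endomorphism_eq_composition[OF \<sigma> p]
    by (auto simp: Spec_map_def point_filter_def carrier_Free_MV)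
qed

subsection \<open>Point filters\<close>

text \<open>The coefficient pair of the function \<open>k * (1 - l)\<close>, which turns the strict
  condition \<open>l < 1\<close> into a threshold condition.\<close>

definition aff_compl :: "nat \<Rightarrow> (int ^ 'n) \<times> int \<Rightarrow> (int ^ 'n) \<times> int" where
  "aff_compl k l = (\<chi> i. - int k * fst l $ i, int k * (1 - snd l))"

lemma aff_aff_compl: "aff (aff_compl k l) p = real k * (1 - aff l p)"
  by (simp add: aff_def aff_compl_def sum_distrib_left sum_negf algebra_simps)

definition clip_aff :: "(int ^ 'n) \<times> int \<Rightarrow> real ^ 'n \<Rightarrow> real" where
  "clip_aff l = (\<lambda>p\<in>cube. clip (aff l p))"

lemma clip_aff_in_McNaughton: "clip_aff l \<in> McNaughton"
proof -
  have "\<exists>m\<in>{0, (0,1), l}. clip (aff l p) = aff m p" for p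
    by (auto simp: clip_def aff_simps max_def min_def)
  then have "\<exists>L. finite L \<and> (\<forall>p\<in>cube. \<exists>m\<in>L. clip (aff l p) = aff m p)"
    by (intro exI[of _ "{0, (0,1), l}"]) simp
  moreover have "continuous_on cube (\<lambda>p. clip (aff l p))"
    unfolding clip_def aff_def by (intro continuous_intros)
  ultimately show ?thesis
    by (auto simp: McNaughton_iff clip_aff_def clip_range cong: continuous_on_cong_simp)
qed

lemma clip_aff_in_point_filter: "p \<in> cube \<Longrightarrow> clip_aff l \<in> point_filter p \<longleftrightarrow> 1 \<le> aff l p"
  by (simp add: point_filter_def clip_aff_in_McNaughton) (simp add: clip_aff_def clip_eq_1_iff)

lemma aff_axis: "aff (axis i k, c) p = of_int k * p $ i + of_int c"
  by (simp add: aff_def axis_def if_distrib[of real_of_int] if_distrib[of "\<lambda>x. x * _"] cong: if_cong)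

text \<open>A box around \<open>q\<close> misses \<open>D\<close>. For each coordinate and each
  direction, a steep function is at least 1 at \<open>q\<close> and at most 0 once the box is left
  that way, so its truncation vanishes there.\<close>

lemma clip_aff_separates_closed:
  fixes D :: "(real ^ 'n) set"
  assumes "closed D" "q \<notin> D"
  shows "\<exists>M. finite M \<and> (\<forall>l\<in>M. 1 \<le> aff l q) \<and> (\<forall>x\<in>cube \<inter> D. \<exists>l\<in>M. clip_aff l x = 0)"
proof -
  from assms obtain e where e: "e > 0" "ball q e \<subseteq> - D"
    using open_contains_ball[of "- D"] by (auto simp: open_Compl)
  \<comment> \<open>A point that differs from \<open>q\<close> by less than \<open>d\<close> in
    every coordinate is within \<open>e\<close> of \<open>q\<close>, since the norm is at most the
    sum of the coordinate differences.\<close>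
  define d where "d = e / real CARD('n)"
  have d: "d > 0" using e by (simp add: d_def)
  \<comment> \<open>Falling from 1 to 0 takes one unit, and rounding the offset to an integer costs
    less than one more; hence the bound 2.\<close>
  then obtain k :: nat where k: "2 < real k * d"
    using reals_Archimedean3[of d] by force
  define M where "M = (\<Union>i\<in>UNIV. {(axis i (int k), 1 - \<lfloor>real k * q $ i\<rfloor>),
    (axis i (- int k), 1 + \<lceil>real k * q $ i\<rceil>)})"
  have "1 \<le> aff l q" if "l \<in> M" for l
    using that by (auto simp: M_def aff_axis)
  moreover have "\<exists>l\<in>M. clip_aff l x = 0" if x: "x \<in> cube" "x \<in> D" for x
  proof -
    have "\<not> (\<forall>i. \<bar>(x - q) $ i\<bar> < d)"
    proof
      assume *: "\<forall>i. \<bar>(x - q) $ i\<bar> < d"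
      have "norm (x - q) \<le> (\<Sum>i\<in>UNIV. \<bar>(x - q) $ i\<bar>)" by (rule norm_le_l1_cart)
      also have "\<dots> < (\<Sum>i\<in>(UNIV::'n set). d)" using * by (intro sum_strict_mono) auto
      also have "\<dots> = e" by (simp add: d_def)
      finally have "x \<in> ball q e" by (simp add: dist_norm norm_minus_commute)
      then show False using e(2) x(2) by blast
    qed
    then obtain i where "\<bar>x $ i - q $ i\<bar> \<ge> d" by (auto simp: not_less)
    then consider "x $ i \<le> q $ i - d" | "x $ i \<ge> q $ i + d" by linarith
    then show ?thesis
    proof cases
      case 1
      then have "real k * x $ i \<le> real k * (q $ i - d)" by (intro mult_left_mono) auto
      then have "aff (axis i (int k), 1 - \<lfloor>real k * q $ i\<rfloor>) x \<le> 0"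
        using k by (simp add: aff_axis algebra_simps) linarith
      then show ?thesis
        using x(1) by (intro bexI[of _ "(axis i (int k), 1 - \<lfloor>real k * q $ i\<rfloor>)"])
          (auto simp: clip_aff_def clip_def M_def)
    next
      case 2
      then have "real k * x $ i \<ge> real k * (q $ i + d)" by (intro mult_left_mono) auto
      then have "aff (axis i (- int k), 1 + \<lceil>real k * q $ i\<rceil>) x \<le> 0"
        using k by (simp add: aff_axis algebra_simps) linarith
      then show ?thesis
        using x(1) by (intro bexI[of _ "(axis i (- int k), 1 + \<lceil>real k * q $ i\<rceil>)"])
          (auto simp: clip_aff_def clip_def M_def)
    qed
  qed
  moreover have "finite M" by (simp add: M_def)
  ultimately show ?thesis by blast
qed

text \<open>Let \<open>a p = 1\<close>. Pieces of \<open>a\<close> with value 1 at \<open>p\<close>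
  have their truncations in \<open>F\<close>. The other pieces occur only on a closed set avoiding
  \<open>p\<close>, and at each point of it one of finitely many members of \<open>F\<close>
  vanishes. A common lower bound of all these lies below \<open>a\<close>.\<close>

lemma point_filter_subset:
  fixes p :: "real ^ 'n"
  assumes F: "mv_filter Free_MV F" and p: "p \<in> cube"
    and cl: "\<And>l. 1 \<le> aff l p \<Longrightarrow> clip_aff l \<in> F"
  shows "point_filter p \<subseteq> F"
proof
  fix a assume "a \<in> point_filter p"
  then have a: "a \<in> McNaughton" "a p = 1" by (auto simp: point_filter_def)
  from a(1) obtain L where L: "finite L" "\<And>x. x \<in> cube \<Longrightarrow> \<exists>l\<in>L. a x = aff l x"
    unfolding McNaughton_iff by blast
  \<comment> \<open>The points of \<open>D\<close> use a piece whose value at \<open>p\<close> is not \<open>1\<close>, so \<open>p \<notin> D\<close>.\<close>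
  define D where "D = (\<Union>l\<in>{l\<in>L. aff l p \<noteq> 1}. cube \<inter> (\<lambda>x. a x - aff l x) -` {0})"
  have D: "closed D" unfolding D_def
    using L(1) McNaughton_cont[OF a(1)]
    by (intro closed_UN ballI continuous_closed_preimage) (auto simp: aff_def intro!: continuous_intros)
  have pD: "p \<notin> D" using a(2) by (auto simp: D_def)
  from clip_aff_separates_closed[OF D pD] obtain M where M: "finite M" "\<forall>l\<in>M. 1 \<le> aff l p"
    "\<forall>x\<in>cube \<inter> D. \<exists>l\<in>M. clip_aff l x = 0" by blast
  let ?T = "clip_aff ` (M \<union> {l\<in>L. aff l p = 1})"
  have "finite ?T" "?T \<subseteq> F" using L(1) M(1,2) cl by auto
  from Free_MV_filter_finite_lower[OF F this] obtain u
    where u: "u \<in> F" "\<forall>t\<in>?T. \<forall>x\<in>cube. u x \<le> t x" by blast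
  show "a \<in> F"
  proof (rule Free_MV_filter_mono[OF F u(1) a(1)])
    fix x :: "real ^ 'n" assume x: "x \<in> cube"
    note r = McNaughton_range[OF a(1) x]
    from L(2)[OF x] obtain l where l: "l \<in> L" "a x = aff l x" by blast
    show "u x \<le> a x"
    proof (cases "aff l p = 1")
      case True
      then have "u x \<le> clip_aff l x" using u(2) x l(1) by blast
      also have "\<dots> = a x" using x r l(2) by (simp add: clip_aff_def clip_def)
      finally show ?thesis .
    next
      case False
      then have "x \<in> D" unfolding D_def using x l by (intro UN_I[of l]) auto
      then obtain m where m: "m \<in> M" "clip_aff m x = 0" using M(3) x by blast
      then have "u x \<le> clip_aff m x" using u(2) x by blast
      then have "u x \<le> 0" using m(2) by simp
      then show ?thesis using r by simp
    qed
  qed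
qed

text \<open>
  The complementary affine function \<open>k (1 - l)\<close> reaches \<open>1\<close> at \<open>p\<close> for some \<open>k\<close> iff \<open>l p < 1\<close>.
  Only countably many affine functions occur, so this describes a Borel set of prime filters.
\<close>

lemma point_filter_image_eq:
  "point_filter ` cube = {P \<in> mv_Spec Free_MV. \<forall>l :: (int ^ 'n) \<times> int. clip_aff l \<in> P \<or>
     (\<exists>k::nat. clip_aff (aff_compl k l) \<in> P)}" (is "_ = ?R")
proof (intro equalityI subsetI)
  fix P :: "(real ^ 'n \<Rightarrow> real) set" assume "P \<in> point_filter ` cube"
  then obtain p where p: "p \<in> cube" "P = point_filter p" by blast
  have "clip_aff l \<in> P \<or> (\<exists>k. clip_aff (aff_compl k l) \<in> P)" for l
  proof (cases "1 \<le> aff l p")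
    case False
    then obtain k :: nat where "1 < real k * (1 - aff l p)"
      using reals_Archimedean3[of "1 - aff l p"] by force
    then have "1 \<le> aff (aff_compl k l) p" by (simp add: aff_aff_compl)
    then show ?thesis using p clip_aff_in_point_filter by blast
  qed (simp add: p clip_aff_in_point_filter)
  then show "P \<in> ?R" using p point_filter_in_Spec by blast
next
  fix P :: "(real ^ 'n \<Rightarrow> real) set" assume P: "P \<in> ?R"
  then have F: "mv_filter Free_MV P" "P \<noteq> McNaughton" by (auto simp: mv_Spec_def carrier_Free_MV)
  then obtain p where p: "p \<in> cube" "P \<subseteq> point_filter p"
    using Free_MV_proper_filter_subset_point_filter by blast
  have "point_filter p \<subseteq> P"
  proof (rule point_filter_subset[OF F(1) p(1)])
    fix l assume l: "1 \<le> aff l p"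
    \<comment> \<open>Membership would carry over to the point filter at \<open>p\<close>, but
      \<open>k * (1 - l)\<close> is at most 0 at \<open>p\<close>; so the first alternative must
      hold.\<close>
    have "clip_aff (aff_compl k l) \<notin> P" for k
    proof
      assume "clip_aff (aff_compl k l) \<in> P"
      then have "1 \<le> real k * (1 - aff l p)"
        using p clip_aff_in_point_filter[OF p(1), of "aff_compl k l"] aff_aff_compl[of k l p] by auto
      moreover have "real k * (1 - aff l p) \<le> 0" using l by (simp add: mult_nonneg_nonpos)
      ultimately show False by simp
    qed
    then show "clip_aff l \<in> P" using P by blast
  qed
  then show "P \<in> point_filter ` cube" using p by blast
qed

text \<open>Singletons are closed, so some truncated affine function is 1 at one point and 0 at the
  other.\<close>

lemma point_filter_inj: "inj_on point_filter cube"
proof (rule inj_onI, rule ccontr)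
  fix p q :: "real ^ 'n"
  assume p: "p \<in> cube" and q: "q \<in> cube" and eq: "point_filter p = point_filter q" and ne: "p \<noteq> q"
  obtain M where M: "\<forall>l\<in>M. 1 \<le> aff l p" "\<forall>x\<in>cube \<inter> {q}. \<exists>l\<in>M. clip_aff l x = 0"
    using clip_aff_separates_closed[of "{q}" p] ne by auto
  then obtain l where l: "1 \<le> aff l p" "clip_aff l q = 0" using q by blast
  then have "clip_aff l \<in> point_filter q" using clip_aff_in_point_filter[OF p, of l] eq by simp
  then show False using l(2) by (simp add: point_filter_def)
qed

subsection \<open>Borel structure\<close>

lemma sets_mv_Spec_borel_openin:
  assumes "mv_algebra A" "openin (mv_Spec_topology A) U"
  shows "U \<in> sets (mv_Spec_borel A)"
proof -
  have "{U. openin (mv_Spec_topology A) U} \<subseteq> Pow (mv_Spec A)"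
    using topspace_mv_Spec_topology[OF assms(1)] openin_subset by blast
  then show ?thesis using assms(2) unfolding mv_Spec_borel_def
    by (auto simp: sets_measure_of)
qed

lemma openin_mv_Spec_subbasic:
  "a \<in> carrier A \<Longrightarrow> openin (mv_Spec_topology A) {P \<in> mv_Spec A. a \<notin> P}"
  unfolding mv_Spec_topology_def by (rule topology_generated_by_Basis) blast

lemma sets_mv_Spec_borel_mem:
  assumes "mv_algebra A" "a \<in> carrier A"
  shows "{P \<in> mv_Spec A. a \<in> P} \<in> sets (mv_Spec_borel A)"
proof -
  have "{P \<in> mv_Spec A. a \<in> P} = space (mv_Spec_borel A) - {P \<in> mv_Spec A. a \<notin> P}" by auto
  then show ?thesis
    using sets_mv_Spec_borel_openin[OF assms(1) openin_mv_Spec_subbasic[OF assms(2)]]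
    by (metis sets.compl_sets)
qed

lemma point_filter_image_borel:
  "point_filter ` (cube :: (real ^ 'n) set) \<in> sets (mv_Spec_borel Free_MV)"
proof -
  let ?V = "\<lambda>l :: (int ^ 'n) \<times> int. {P \<in> mv_Spec Free_MV. clip_aff l \<in> P}"
  have V: "?V l \<in> sets (mv_Spec_borel Free_MV)" for l
    by (rule sets_mv_Spec_borel_mem[OF mv_algebra_Free_MV])
      (simp add: carrier_Free_MV clip_aff_in_McNaughton)
  have cnt: "countable (UNIV :: ((int ^ 'n) \<times> int) set)"
  proof -
    \<comment> \<open>The index type is finite, so \<open>'n \<Rightarrow> int\<close> is countable;
      it maps onto the integer vectors.\<close>
    have "countable (range (\<lambda>f :: 'n \<Rightarrow> int. vec_lambda f))" by simp
    moreover have "range (\<lambda>f :: 'n \<Rightarrow> int. vec_lambda f) = UNIV"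
      by (metis surj_def vec_lambda_eta)
    ultimately have "countable (UNIV :: (int ^ 'n) set)" by simp
    then have "countable ((UNIV :: (int ^ 'n) set) \<times> (UNIV :: int set))" by (rule countable_SIGMA) simp
    then show ?thesis by simp
  qed
  have "point_filter ` (cube :: (real ^ 'n) set) = (\<Inter>l. ?V l \<union> (\<Union>k. ?V (aff_compl k l)))"
    unfolding point_filter_image_eq by (auto simp del: split_paired_All)
  also have "\<dots> \<in> sets (mv_Spec_borel Free_MV)"
  proof (rule sets.countable_INT'[OF cnt])
    have "(\<Union>k. ?V (aff_compl k l)) \<in> sets (mv_Spec_borel Free_MV)" for l
      by (rule sets.countable_UN) (use V in blast)
    then show "range (\<lambda>l. ?V l \<union> (\<Union>k. ?V (aff_compl k l))) \<subseteq> sets (mv_Spec_borel Free_MV)"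
      using V sets.Un by blast
  qed simp
  finally show ?thesis .
qed

text \<open>\<open>W\<close> is the union of the subbasic sets of all functions that are 1 on the
  cube off \<open>U\<close>, so it contains no point filter from there. For \<open>q\<close> in
  \<open>U\<close>, a function \<open>u\<close> that is 1 at \<open>q\<close> and 0 off
  \<open>U\<close> has a negation that puts \<open>q\<close> into the preimage.\<close>

lemma open_cube_eq_preimage:
  assumes "open (U :: (real ^ 'n) set)"
  shows "\<exists>W\<in>sets (mv_Spec_borel Free_MV). point_filter -` W \<inter> cube = U \<inter> cube"
proof -
  let ?O = "\<lambda>a :: real ^ 'n \<Rightarrow> real. {P \<in> mv_Spec Free_MV. a \<notin> P}"
  define N where "N = {a \<in> McNaughton. \<forall>x\<in>cube. x \<notin> U \<longrightarrow> a x = 1}"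
  define W where "W = \<Union> (?O ` N)"
  have "openin (mv_Spec_topology Free_MV) W"
    unfolding W_def using openin_mv_Spec_subbasic[of _ Free_MV]
    by (intro openin_Union) (auto simp: N_def carrier_Free_MV)
  then have "W \<in> sets (mv_Spec_borel Free_MV)"
    by (rule sets_mv_Spec_borel_openin[OF mv_algebra_Free_MV])
  moreover have "point_filter -` W \<inter> cube = U \<inter> cube"
  proof (intro equalityI subsetI)
    fix q :: "real ^ 'n" assume "q \<in> point_filter -` W \<inter> cube"
    then obtain a where "a \<in> N" "a \<notin> point_filter q" "q \<in> cube" by (auto simp: W_def)
    then show "q \<in> U \<inter> cube" by (auto simp: N_def point_filter_def)
  next
    fix q :: "real ^ 'n" assume q: "q \<in> U \<inter> cube"
    obtain M where M: "finite M" "\<forall>l\<in>M. 1 \<le> aff l q"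
      "\<forall>x\<in>cube \<inter> - U. \<exists>l\<in>M. clip_aff l x = 0"
      using clip_aff_separates_closed[of "- U" q] assms q by (auto simp: closed_Compl)
    have F: "mv_filter Free_MV (point_filter q)"
      using point_filter_in_Spec q by (auto simp: mv_Spec_def)
    have "finite (clip_aff ` M)" "clip_aff ` M \<subseteq> point_filter q"
      using M(1,2) q by (auto simp: clip_aff_in_point_filter)
    from Free_MV_filter_finite_lower[OF F this] obtain u
      where u: "u \<in> point_filter q" "\<forall>t\<in>clip_aff ` M. \<forall>x\<in>cube. u x \<le> t x" by blast
    have uM: "u \<in> McNaughton" "u q = 1" using u(1) by (auto simp: point_filter_def)
    have u0: "u x = 0" if x: "x \<in> cube" "x \<notin> U" for x
    proof -
      obtain l where "l \<in> M" "clip_aff l x = 0" using M(3) x by blast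
      then show ?thesis using u(2) x(1) McNaughton_range[OF uM(1) x(1)] by force
    qed
    interpret A: mv_algebra "Free_MV :: (real ^ 'n \<Rightarrow> real) mv_alg" by (rule mv_algebra_Free_MV)
    let ?a = "u \<leadsto>\<^bsub>Free_MV\<^esub> \<bottom>\<^bsub>Free_MV\<^esub>"
    have "?a \<in> McNaughton" using A.imp_closed A.zero_closed uM by (simp add: carrier_Free_MV)
    then have "?a \<in> N" using u0 by (auto simp: N_def Free_MV_def)
    moreover have "?a \<notin> point_filter q" using q uM by (simp add: point_filter_def Free_MV_def)
    ultimately show "q \<in> point_filter -` W \<inter> cube"
      using q point_filter_in_Spec by (auto simp: W_def)
  qed
  ultimately show ?thesis by blast
qed

text \<open>The preimages form a sigma-algebra containing the traces of open sets, hence all Borel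
  subsets of the cube. This is phrased as measurability of the identity out of
  \<open>?V\<close>.\<close>

lemma sets_cube_measure_eq_preimage:
  assumes "E \<in> sets (cube_measure :: (real ^ 'n) measure)"
  shows "\<exists>W\<in>sets (mv_Spec_borel Free_MV). E = point_filter -` W \<inter> cube"
proof -
  let ?X = "mv_Spec_borel Free_MV :: (real ^ 'n \<Rightarrow> real) set measure"
  let ?V = "vimage_algebra cube point_filter ?X"
  have pf: "point_filter \<in> cube \<rightarrow> space ?X" using point_filter_in_Spec by auto
  have "(\<lambda>x. x) \<in> measurable ?V borel"
  proof (rule borel_measurableI)
    fix S :: "(real ^ 'n) set" assume "open S"
    then show "(\<lambda>x. x) -` S \<inter> space ?V \<in> sets ?V"
      using open_cube_eq_preimage[of S] by (auto simp: sets_vimage_algebra2[OF pf])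
  qed
  then have "(\<lambda>x. x) \<in> measurable ?V (restrict_space borel cube)"
    by (intro measurable_restrict_space2) auto
  moreover have "E \<in> sets (restrict_space borel cube)"
    using assms by (simp add: cube_measure_def sets_restrict_space)
  ultimately have "(\<lambda>x. x) -` E \<inter> space ?V \<in> sets ?V" by (rule measurable_sets)
  moreover have "E \<subseteq> cube" using sets.sets_into_space[OF assms] by simp
  ultimately have "E \<in> sets ?V" by (simp add: Int_absorb2)
  then show ?thesis by (auto simp: sets_vimage_algebra2[OF pf])
qed

text \<open>If \<open>E\<close> is the preimage of \<open>W\<close>, its image is \<open>W\<close>
  cut down to the Borel image of the cube. This makes the inverse of \<open>point_filter\<close>
  measurable.\<close>

lemma point_filter_image_sets:
  assumes "E \<in> sets (cube_measure :: (real ^ 'n) measure)"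
  shows "point_filter ` E \<in> sets (mv_Spec_borel Free_MV)"
proof -
  from sets_cube_measure_eq_preimage[OF assms] obtain W
    where W: "W \<in> sets (mv_Spec_borel Free_MV)" "E = point_filter -` W \<inter> cube" by blast
  then have "point_filter ` E = W \<inter> point_filter ` cube" by auto
  then show ?thesis using W(1) point_filter_image_borel sets.Int by metis
qed

section \<open>Measurability of the dual map and of the map on prime filters\<close>

lemma dual_map_measurable:
  fixes \<sigma> :: "(real ^ 'n \<Rightarrow> real) \<Rightarrow> (real ^ 'n \<Rightarrow> real)"
  assumes \<sigma>: "\<sigma> \<in> mv_hom Free_MV Free_MV"
  shows "dual_map \<sigma> \<in> measurable cube_measure cube_measure"
proof -
  have "\<sigma> (gen i) \<in> McNaughton" for i
    using \<sigma> gen_in_McNaughton[of i] by (auto simp: mv_hom_def hom_def carrier_Free_MV)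
  then have "continuous_on cube (dual_map \<sigma>)"
    unfolding dual_map_def by (intro continuous_on_vec_lambda McNaughton_cont)
  then have "dual_map \<sigma> \<in> measurable (restrict_space borel cube) borel"
    by (rule borel_measurable_continuous_on_restrict)
  then have "dual_map \<sigma> \<in> measurable (restrict_space borel cube) (restrict_space borel cube)"
    using dual_map_cube[OF \<sigma>]
    by (intro measurable_restrict_space2) (auto simp: space_restrict_space)
  also have "measurable (restrict_space borel cube) (restrict_space borel cube) =
      measurable cube_measure (cube_measure :: (real ^ 'n) measure)"
    by (rule measurable_cong_sets) (simp_all add: cube_measure_def sets_restrict_space)
  finally show ?thesis .
qed

text \<open>The map is continuous, because the preimage of the subbasic set of \<open>a\<close> is
  the subbasic set of \<open>\<sigma> a\<close>.\<close>

lemma Spec_map_measurable: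
  assumes A: "mv_algebra A" and \<sigma>: "\<sigma> \<in> mv_hom A A"
  shows "Spec_map A \<sigma> \<in> measurable (mv_Spec_borel A) (mv_Spec_borel A)"
proof -
  interpret A: mv_algebra A by fact
  have S: "Spec_map A \<sigma> P \<in> mv_Spec A" if "P \<in> mv_Spec A" for P
    by (rule Spec_map_in_Spec[OF \<sigma> A that])
  note top = topspace_mv_Spec_topology[OF A]
  have cont: "continuous_map (mv_Spec_topology A) (mv_Spec_topology A) (Spec_map A \<sigma>)"
    unfolding mv_Spec_topology_def[of A]
  proof (rule continuous_on_generated_topo, unfold mv_Spec_topology_def[of A, symmetric] top)
    fix U assume "U \<in> {{P \<in> mv_Spec A. a \<notin> P} | a. a \<in> carrier A}"
    then obtain a where a: "a \<in> carrier A" and U: "U = {P \<in> mv_Spec A. a \<notin> P}" by blast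
    have "Spec_map A \<sigma> -` U \<inter> mv_Spec A = {P \<in> mv_Spec A. \<sigma> a \<notin> P}"
      using S a by (auto simp: U Spec_map_def)
    moreover have "\<sigma> a \<in> carrier A" using \<sigma> a by (auto simp: mv_hom_def hom_def)
    ultimately show "openin (mv_Spec_topology A) (Spec_map A \<sigma> -` U \<inter> mv_Spec A)"
      using openin_mv_Spec_subbasic by metis
  next
    have "\<Union> {{P \<in> mv_Spec A. a \<notin> P} | a. a \<in> carrier A} = mv_Spec A"
      using top unfolding mv_Spec_topology_def topology_generated_by_topspace .
    then show "Spec_map A \<sigma> ` mv_Spec A \<subseteq> \<Union> {{P \<in> mv_Spec A. a \<notin> P} | a. a \<in> carrier A}"
      using S by blast
  qed
  show ?thesis
    unfolding mv_Spec_borel_def[of A]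
  proof (rule measurable_measure_of, unfold mv_Spec_borel_def[of A, symmetric])
    show "{U. openin (mv_Spec_topology A) U} \<subseteq> Pow (mv_Spec A)"
      using top openin_subset by blast
    show "Spec_map A \<sigma> \<in> space (mv_Spec_borel A) \<rightarrow> mv_Spec A" using S by auto
    fix U assume "U \<in> {U. openin (mv_Spec_topology A) U}"
    then have "openin (mv_Spec_topology A) {P \<in> mv_Spec A. Spec_map A \<sigma> P \<in> U}"
      using cont top by (auto simp: continuous_map_def)
    then have "{P \<in> mv_Spec A. Spec_map A \<sigma> P \<in> U} \<in> sets (mv_Spec_borel A)"
      by (rule sets_mv_Spec_borel_openin[OF A])
    moreover have "Spec_map A \<sigma> -` U \<inter> space (mv_Spec_borel A) = {P \<in> mv_Spec A. Spec_map A \<sigma> P \<in> U}"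
      by auto
    ultimately show "Spec_map A \<sigma> -` U \<inter> space (mv_Spec_borel A) \<in> sets (mv_Spec_borel A)"
      by simp
  qed
qed

section \<open>Transfer of measure and dynamics between the cube and the spectrum\<close>

lemma sets_Spec_measure: "sets Spec_measure = sets (mv_Spec_borel Free_MV)"
  and space_Spec_measure: "space Spec_measure = mv_Spec Free_MV"
  by (simp_all add: Spec_measure_def)

lemma emeasure_Spec_measure_eq_cube_measure:
  "W \<in> sets (mv_Spec_borel Free_MV) \<Longrightarrow>
     emeasure Spec_measure W = emeasure cube_measure (point_filter -` W \<inter> cube)"
  unfolding Spec_measure_def by (simp add: emeasure_distr[OF point_filter_measurable])

theorem theorem3p1:
  fixes \<sigma> :: "(real ^ 'n \<Rightarrow> real) \<Rightarrow> (real ^ 'n \<Rightarrow> real)"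
  assumes "\<sigma> \<in> mv_hom Free_MV Free_MV"
  shows "(nonsingular cube_measure (dual_map \<sigma>) \<longleftrightarrow>
            nonsingular Spec_measure (Spec_map Free_MV \<sigma>)) \<and>
         (nonsingular cube_measure (dual_map \<sigma>) \<longrightarrow>
            isomorphic_under cube_measure (dual_map \<sigma>)
              Spec_measure (Spec_map Free_MV \<sigma>) point_filter)"
proof -
  let ?X = "mv_Spec_borel Free_MV :: (real ^ 'n \<Rightarrow> real) set measure"
  let ?S = "Spec_map Free_MV \<sigma>" and ?s = "dual_map \<sigma>"
  let ?C = "cube_measure :: (real ^ 'n) measure"
  let ?N = "Spec_measure :: (real ^ 'n \<Rightarrow> real) set measure"
  note conj = Spec_map_point_filter[OF assms] and cube = dual_map_cube[OF assms]
  have ms: "?s \<in> measurable ?C ?C" by (rule dual_map_measurable[OF assms])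
  have mS: "?S \<in> measurable ?X ?X" by (rule Spec_map_measurable[OF mv_algebra_Free_MV assms])
  then have mS': "?S \<in> measurable ?N ?N"
    by (simp add: measurable_cong_sets[OF sets_Spec_measure sets_Spec_measure])
  \<comment> \<open>By the conjugacy, pulling the \<open>?S\<close>-preimage of \<open>W\<close>
    back to the cube gives the \<open>?s\<close>-preimage of the pullback of \<open>W\<close>. Both
    directions of the equivalence rest on this.\<close>
  have pre: "emeasure ?N (?S -` W \<inter> mv_Spec Free_MV) =
      emeasure ?C (?s -` (point_filter -` W \<inter> cube) \<inter> cube)" if W: "W \<in> sets ?X" for W
  proof -
    have "point_filter -` (?S -` W \<inter> mv_Spec Free_MV) \<inter> cube = ?s -` (point_filter -` W \<inter> cube) \<inter> cube"
    proof (rule Set.set_eqI)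
      show "p \<in> point_filter -` (?S -` W \<inter> mv_Spec Free_MV) \<inter> cube \<longleftrightarrow>
          p \<in> ?s -` (point_filter -` W \<inter> cube) \<inter> cube" for p
        using conj[of p] cube[of p] point_filter_in_Spec[of p] by (cases "p \<in> cube") simp_all
    qed
    then show ?thesis
      using emeasure_Spec_measure_eq_cube_measure[of "?S -` W \<inter> mv_Spec Free_MV"]
        measurable_sets[OF mS W] by simp
  qed
  have iff: "nonsingular ?C ?s \<longleftrightarrow> nonsingular ?N ?S"
  proof
    assume ns: "nonsingular ?C ?s"
    show "nonsingular ?N ?S"
      unfolding nonsingular_def
    proof (intro conjI mS' ballI impI)
      fix W assume W: "W \<in> sets ?N" "emeasure ?N W = 0"
      then have WX: "W \<in> sets ?X" by (simp add: sets_Spec_measure)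
      then have "point_filter -` W \<inter> cube \<in> sets ?C"
        using measurable_sets[OF point_filter_measurable WX] by simp
      moreover have "emeasure ?C (point_filter -` W \<inter> cube) = 0"
        using W(2) emeasure_Spec_measure_eq_cube_measure[OF WX] by simp
      ultimately have "emeasure ?C (?s -` (point_filter -` W \<inter> cube) \<inter> space ?C) = 0"
        using ns unfolding nonsingular_def by blast
      then show "emeasure ?N (?S -` W \<inter> space ?N) = 0"
        unfolding space_Spec_measure pre[OF WX] space_cube_measure .
    qed
  next
    assume ns: "nonsingular ?N ?S"
    show "nonsingular ?C ?s"
      unfolding nonsingular_def
    proof (intro conjI ms ballI impI)
      fix E assume E: "E \<in> sets ?C" "emeasure ?C E = 0"
      \<comment> \<open>Null sets of the cube have to come from null sets of the spectrum:
        \<open>E\<close> is the preimage of a Borel set \<open>W\<close> of the same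
        measure.\<close>
      from sets_cube_measure_eq_preimage[OF E(1)] obtain W
        where W: "W \<in> sets ?X" "E = point_filter -` W \<inter> cube" by blast
      have "emeasure ?N W = 0"
        using E(2) W(2) emeasure_Spec_measure_eq_cube_measure[OF W(1)] by simp
      then have "emeasure ?N (?S -` W \<inter> space ?N) = 0"
        using ns W(1) unfolding nonsingular_def sets_Spec_measure by blast
      then show "emeasure ?C (?s -` E \<inter> space ?C) = 0"
        unfolding space_Spec_measure pre[OF W(1)] space_cube_measure W(2) .
    qed
  qed
  let ?B = "point_filter ` (cube :: (real ^ 'n) set)"
  have B: "?B \<in> sets ?N" using point_filter_image_borel by (simp add: sets_Spec_measure)
  have "isomorphic_under ?C ?s ?N ?S point_filter"
    unfolding isomorphic_under_def
  proof (intro bexI[of _ "cube"] bexI[of _ ?B] conjI ballI)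
    show "space ?C - cube \<in> null_sets ?C" by simp
    have Bc: "mv_Spec Free_MV - ?B \<in> sets ?X"
      using point_filter_image_borel by (metis sets.compl_sets space_mv_Spec_borel)
    \<comment> \<open>No point of the cube is sent outside \<open>?B\<close>, so the push-forward
      measure of the complement is 0.\<close>
    have "point_filter -` (mv_Spec Free_MV - ?B) \<inter> (cube :: (real ^ 'n) set) = {}" by auto
    then show "space ?N - ?B \<in> null_sets ?N"
      using Bc emeasure_Spec_measure_eq_cube_measure[OF Bc]
      by (simp add: null_sets_def sets_Spec_measure space_Spec_measure)
    show "?s ` cube \<subseteq> cube" using cube by blast
    show "?S ` ?B \<subseteq> ?B" using conj cube by auto
    show bij: "bij_betw point_filter cube ?B" by (simp add: bij_betw_def point_filter_inj)
    have "point_filter \<in> measurable ?C ?N"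
      using point_filter_measurable by (simp add: measurable_cong_sets[OF refl sets_Spec_measure])
    then show "point_filter \<in> measurable (restrict_space ?C cube) (restrict_space ?N ?B)"
      by (intro measurable_restrict_space2 measurable_restrict_space1)
        (auto simp: space_restrict_space)
    show "the_inv_into cube point_filter \<in> measurable (restrict_space ?N ?B) (restrict_space ?C cube)"
    proof (rule measurableI)
      fix P assume "P \<in> space (restrict_space ?N ?B)"
      then show "the_inv_into cube point_filter P \<in> space (restrict_space ?C cube)"
        using bij by (auto simp: space_restrict_space the_inv_into_f_f point_filter_inj)
    next
      fix E assume "E \<in> sets (restrict_space ?C cube)"
      then have E: "E \<in> sets ?C" "E \<subseteq> cube"
        using sets.top[of ?C] by (simp_all add: sets_restrict_space_iff)
      \<comment> \<open>Preimages under the inverse are forward images, which are Borel by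
        \<open>point_filter_image_sets\<close>.\<close>
      have "the_inv_into cube point_filter -` E \<inter> space (restrict_space ?N ?B) = point_filter ` E"
        using E(2) point_filter_in_Spec
        by (auto simp: space_restrict_space space_Spec_measure the_inv_into_f_f point_filter_inj subset_iff)
      moreover have "point_filter ` E \<in> sets (restrict_space ?N ?B)"
        using B E point_filter_image_sets[OF E(1)]
        by (simp add: sets_restrict_space_iff image_mono sets_Spec_measure)
      ultimately show "the_inv_into cube point_filter -` E \<inter> space (restrict_space ?N ?B)
          \<in> sets (restrict_space ?N ?B)" by simp
    qed
    show "emeasure ?C (point_filter -` E \<inter> cube) = emeasure ?N E"
      if "E \<in> sets (restrict_space ?N ?B)" for E
      using that B emeasure_Spec_measure_eq_cube_measure[of E]
      by (simp add: sets_restrict_space_iff sets_Spec_measure)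
    show "point_filter (?s p) = ?S (point_filter p)" if "p \<in> cube" for p
      using conj[OF that] by simp
    show "?B \<in> sets ?N" by (rule B)
    show "cube \<in> sets ?C" using sets.top[of ?C] by simp
  qed
  with iff show ?thesis by blast
qed

end
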